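(* Let $U\subseteq\mathbb{M}\mathbb{C}(n)$ be open and let $\mathbf{i}\in\mathbb{I}(n)$ with $\mathbf{i}^2=-1$. If $F\in\mathrm{Hol}_{\mathbf{i}}(U)$ or $F\in\overline{\mathrm{Hol}}_{\mathbf{i}}(U)$, then $\Delta F=0$, where $\Delta=\sum_{\vec{b}\in\mathbb{F}_2^n}\partial^2/\partial x_{\vec{b}}^2$ is the canonical Laplacian. Equivalently, each of the $2^n$ real components of $F$ is harmonic on $U$.
   Context: Let $n\ge1$. The multicomplex numbers are defined recursively by $\mathbb{M}\mathbb{C}(0)=\mathbb{R}$ and $\mathbb{M}\mathbb{C}(n)=\{\eta_1+\eta_2\mathbf{i}_n:\eta_1,\eta_2\in\mathbb{M}\mathbb{C}(n-1)\}$ with $\mathbf{i}_n^2=-1$, where $\mathbf{i}_n$ is a new formal square root of $-1$ commuting with everything. Thus $\mathbb{M}\mathbb{C}(n)$ is a commutative unital real algebra of dimension $2^n$ generated by commuting units $\mathbf{i}_1,\dots,\mathbf{i}_n$ with $\mathbf{i}_k^2=-1$. For $\vec{b}\in\mathbb{F}_2^n$ put $\mathbf{i}^{\vec{b}}:=\mathbf{i}_1^{b_1}\cdots\mathbf{i}_n^{b_n}$; these $2^n$ monomials form a real basis, denoted $\mathbb{I}(n)$, and the canonical coordinates $x_{\vec{b}}\in\mathbb{R}$ are defined by $\eta=\sum_{\vec{b}}x_{\vec{b}}\mathbf{i}^{\vec{b}}$. The real components of $F$ are its coefficients in this basis. Let $\mathcal{L}_{\mathbf{i}}(\eta)=\mathbf{i}\eta$.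 With $DF(\eta)$ the real differential and $C^1$ meaning continuously differentiable between real vector spaces, $\mathrm{Hol}_{\mathbf{i}}(U)$ (resp. $\overline{\mathrm{Hol}}_{\mathbf{i}}(U)$) is the set of $C^1$ functions $F:U\to\mathbb{M}\mathbb{C}(n)$ with $DF(\eta)\circ\mathcal{L}_{\mathbf{i}}=\mathcal{L}_{\mathbf{i}}\circ DF(\eta)$ (resp. $DF(\eta)\circ\mathcal{L}_{\mathbf{i}}=-\mathcal{L}_{\mathbf{i}}\circ DF(\eta)$) for every $\eta\in U$. *)

theory Defs
  imports "HOL-Analysis.Analysis" "HOL-Library.Z2"
begin

text \<open>
  \<open>MC(n)\<close> is the type \<open>'n multicomplex\<close> with \<open>n = CARD('n)\<close>; as types are non-empty,
  \<open>n \<ge> 1\<close> is automatic.  Elements of \<open>'n\<close> label the units, and an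
  element is its family of canonical real coordinates, indexed by \<open>b \<in> F_2^n\<close>.
  The topology and the norm are those of the underlying Euclidean space.
  That this algebra is the one obtained by iterated adjunction of square roots of \<open>-1\<close> is
  shown in the lemmas named \<open>mc_rec\<close> below.
\<close>

instance bit :: finite
proof
  have "(UNIV :: bit set) = {0, 1}"
    using bit.exhaust by blast
  then show "finite (UNIV :: bit set)"
    by (metis finite.emptyI finite.insertI)
qed

typedef 'n multicomplex = "UNIV :: (real ^ (bit ^ 'n::finite)) set"
  morphisms mc_vec Mc ..

definition mc_coord :: "bit ^ 'n::finite \<Rightarrow> 'n multicomplex \<Rightarrow> real"
  where "mc_coord b x = mc_vec x $ b"

lemma mc_vec_Mc [simp]: "mc_vec (Mc v) = v"
  by (simp add: Mc_inverse)

lemma mc_coord_Mc [simp]: "mc_coord b (Mc v) = v $ b"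
  by (simp add: mc_coord_def)

lemma mc_eqI: "(\<And>b. mc_coord b x = mc_coord b y) \<Longrightarrow> x = y"
  by (simp add: mc_coord_def vec_eq_iff flip: mc_vec_inject)

lemma mc_eq_iff: "x = y \<longleftrightarrow> (\<forall>b. mc_coord b x = mc_coord b y)"
  using mc_eqI by blast


subsection \<open>Euclidean space structure\<close>

instantiation multicomplex :: (finite) real_vector
begin
definition "0 = Mc 0"
definition "x + y = Mc (mc_vec x + mc_vec y)"
definition "x - y = Mc (mc_vec x - mc_vec y)"
definition "- x = Mc (- mc_vec x)"
definition "r *\<^sub>R x = Mc (r *\<^sub>R mc_vec x)"
instance
  by standard
    (simp_all add: zero_multicomplex_def plus_multicomplex_def minus_multicomplex_def
      uminus_multicomplex_def scaleR_multicomplex_def algebra_simps mc_vec_inverse)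
end

lemma mc_vec_simps [simp]:
  "mc_vec 0 = 0" "mc_vec (x + y) = mc_vec x + mc_vec y" "mc_vec (x - y) = mc_vec x - mc_vec y"
  "mc_vec (- x) = - mc_vec x" "mc_vec (r *\<^sub>R x) = r *\<^sub>R mc_vec x"
  by (simp_all add: zero_multicomplex_def plus_multicomplex_def minus_multicomplex_def
      uminus_multicomplex_def scaleR_multicomplex_def)

lemma mc_coord_simps [simp]:
  "mc_coord b 0 = 0" "mc_coord b (x + y) = mc_coord b x + mc_coord b y"
  "mc_coord b (x - y) = mc_coord b x - mc_coord b y"
  "mc_coord b (- x) = - mc_coord b x" "mc_coord b (r *\<^sub>R x) = r * mc_coord b x"
  by (simp_all add: mc_coord_def)

lemma mc_coord_sum [simp]: "mc_coord b (\<Sum>i\<in>A. f i) = (\<Sum>i\<in>A. mc_coord b (f i))"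
  by (induction A rule: infinite_finite_induct) auto

instantiation multicomplex :: (finite) real_inner
begin
definition "inner x y = inner (mc_vec x) (mc_vec y)"
definition "norm x = norm (mc_vec x)"
definition "sgn (x :: 'a multicomplex) = x /\<^sub>R norm x"
definition "dist (x :: 'a multicomplex) y = norm (x - y)"
definition "(uniformity :: ('a multicomplex \<times> 'a multicomplex) filter) =
  (INF e\<in>{0 <..}. principal {(x, y). dist x y < e})"
definition "open (S :: 'a multicomplex set) \<longleftrightarrow>
  (\<forall>x\<in>S. eventually (\<lambda>(x', y). x' = x \<longrightarrow> y \<in> S) uniformity)"
instance
proof
  show "inner x x = 0 \<longleftrightarrow> x = 0" for x :: "'a multicomplex"
    by (simp add: inner_multicomplex_def flip: mc_vec_inject)
qed (simp_all add: inner_multicomplex_def norm_multicomplex_def sgn_multicomplex_def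
    dist_multicomplex_def uniformity_multicomplex_def open_multicomplex_def inner_commute
    inner_add_right norm_eq_sqrt_inner)
end

instantiation multicomplex :: (finite) euclidean_space
begin
definition "Basis = range (\<lambda>b. Mc (axis b 1))"
instance
proof
  show "finite (Basis :: 'a multicomplex set)" "(Basis :: 'a multicomplex set) \<noteq> {}"
    by (simp_all add: Basis_multicomplex_def)
  show "inner u v = (if u = v then 1 else 0)" if "u \<in> Basis" "v \<in> Basis"
    for u v :: "'a multicomplex"
    using that by (auto simp: Basis_multicomplex_def inner_multicomplex_def inner_axis_axis
        axis_eq_axis Mc_inject)
  show "(\<forall>u\<in>Basis. inner x u = 0) \<longleftrightarrow> x = 0" for x :: "'a multicomplex"
    by (auto simp: Basis_multicomplex_def inner_multicomplex_def inner_axis mc_eq_iff mc_coord_def)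
qed
end


subsection \<open>Algebra structure\<close>

text \<open>
  Reordering commuting units with square \<open>-1\<close> gives \<open>i^a * i^c = mc_sign a c * i^(a + c)\<close>:
  each unit occurring in both monomials contributes a factor \<open>-1\<close>.  The product is the
  bilinear extension.
\<close>

definition mc_sign :: "bit ^ 'n::finite \<Rightarrow> bit ^ 'n \<Rightarrow> real"
  where "mc_sign a c = (\<Prod>k\<in>UNIV. if a $ k = 1 \<and> c $ k = 1 then -1 else 1)"

lemma bit_vec_minus: "(a :: bit ^ 'n::finite) - c = a + c"
  by (simp add: vec_eq_iff)

lemma bit_vec_add_self [simp]: "(a :: bit ^ 'n::finite) + a = 0"
  by (metis bit_vec_minus right_minus_eq)

lemma bit_vec_add_self2 [simp]: "(a :: bit ^ 'n::finite) + (a + c) = c"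
  by (simp flip: add.assoc)

lemma mc_sign_commute: "mc_sign a c = mc_sign c a"
  by (simp add: mc_sign_def conj_commute)

lemma mc_sign_0 [simp]: "mc_sign 0 a = 1" "mc_sign a 0 = 1"
  by (simp_all add: mc_sign_def)

lemma mc_sign_add_right: "mc_sign a (c + d) = mc_sign a c * mc_sign a d"
proof -
  have "(if x = 1 \<and> y + z = 1 then -1 else 1 :: real) =
     (if x = 1 \<and> y = 1 then -1 else 1) * (if x = 1 \<and> z = 1 then -1 else 1)" for x y z :: bit
    by (cases y; cases z) auto
  then show ?thesis
    by (simp add: mc_sign_def flip: prod.distrib)
qed

lemma mc_sign_add_left: "mc_sign (c + d) a = mc_sign c a * mc_sign d a"
  by (metis mc_sign_add_right mc_sign_commute)

lemma mc_sign_square: "mc_sign a c * mc_sign a c = 1"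
  unfolding mc_sign_def prod.distrib[symmetric] by (rule prod.neutral) auto

lemma sum_bit_vec_shift: "(\<Sum>c\<in>UNIV. f (a + c)) = (\<Sum>c\<in>UNIV. f (c :: bit ^ 'n::finite))"
  by (rule sum.reindex_bij_witness[where i = "\<lambda>c. a + c" and j = "\<lambda>c. a + c"]) auto

instantiation multicomplex :: (finite) "{comm_ring_1, real_algebra_1}"
begin
definition "1 = Mc (axis 0 1)"
definition "x * y = Mc (\<chi> d. \<Sum>a\<in>UNIV. \<Sum>c\<in>UNIV.
  if a + c = d then mc_sign a c * mc_coord a x * mc_coord c y else 0)"

lemma mc_coord_1: "mc_coord b (1 :: 'a multicomplex) = (if b = 0 then 1 else 0)"
  by (simp add: one_multicomplex_def axis_def)

lemma mc_coord_times:
  "mc_coord d ((x :: 'a multicomplex) * y) =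
     (\<Sum>a\<in>UNIV. mc_sign a (a + d) * mc_coord a x * mc_coord (a + d) y)"
proof -
  have eq: "a + c = d \<longleftrightarrow> c = a + d" for a c :: "bit ^ 'a"
    by (metis bit_vec_add_self2)
  show ?thesis
    by (simp add: times_multicomplex_def eq)
qed

instance
proof
  fix x y z :: "'a multicomplex" and r :: real
  show "x * y * z = x * (y * z)"
  proof (rule mc_eqI)
    fix d :: "bit ^ 'a"
    have "mc_coord d (x * y * z) =
      (\<Sum>c\<in>UNIV. \<Sum>a\<in>UNIV. mc_sign c (c + d) * mc_sign a (a + c) *
        mc_coord a x * mc_coord (a + c) y * mc_coord (c + d) z)"
      by (simp add: mc_coord_times sum_distrib_left sum_distrib_right mult_ac)
    also have "\<dots> = (\<Sum>a\<in>UNIV. \<Sum>c\<in>UNIV. mc_sign c (c + d) * mc_sign a (a + c) *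
        mc_coord a x * mc_coord (a + c) y * mc_coord (c + d) z)"
      by (rule sum.swap)
    also have "\<dots> = (\<Sum>a\<in>UNIV. \<Sum>c\<in>UNIV. mc_sign (a + c) (a + c + d) * mc_sign a c *
        mc_coord a x * mc_coord c y * mc_coord (a + c + d) z)"
    proof (rule sum.cong[OF refl])
      fix a :: "bit ^ 'a"
      show "(\<Sum>c\<in>UNIV. mc_sign c (c + d) * mc_sign a (a + c) *
          mc_coord a x * mc_coord (a + c) y * mc_coord (c + d) z) =
        (\<Sum>c\<in>UNIV. mc_sign (a + c) (a + c + d) * mc_sign a c *
          mc_coord a x * mc_coord c y * mc_coord (a + c + d) z)"
        by (subst sum_bit_vec_shift[of _ a, symmetric]) simp
    qed
    also have "\<dots> = mc_coord d (x * (y * z))"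
    proof -
      have "mc_sign (a + c) (a + c + d) * mc_sign a c =
          mc_sign a (a + d) * mc_sign c (c + (a + d))" for a c :: "bit ^ 'a"
      proof -
        have "mc_sign (a + c) (a + c + d) * mc_sign a c =
            (mc_sign c a * mc_sign a c) * (mc_sign a a * mc_sign a c * mc_sign a d * mc_sign c c * mc_sign c d)"
          by (simp add: mc_sign_add_left mc_sign_add_right mult_ac)
        also have "mc_sign c a * mc_sign a c = 1"
          by (metis mc_sign_commute mc_sign_square)
        also have "1 * (mc_sign a a * mc_sign a c * mc_sign a d * mc_sign c c * mc_sign c d) =
            (mc_sign a c * mc_sign a c) * (mc_sign a a * mc_sign a d * mc_sign c c * mc_sign c d) * mc_sign a c"
          by (simp add: mc_sign_square)
        also have "\<dots> = mc_sign a (a + d) * mc_sign c (c + (a + d))"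
          using mc_sign_commute[of c a] mc_sign_square[of a c]
          by (simp add: mc_sign_add_left mc_sign_add_right mult_ac)
        finally show ?thesis .
      qed
      then show ?thesis
        by (simp add: mc_coord_times sum_distrib_left sum_distrib_right mult_ac add_ac)
    qed
    finally show "mc_coord d (x * y * z) = mc_coord d (x * (y * z))" .
  qed
  show comm: "x * y = y * x" for x y :: "'a multicomplex"
  proof (rule mc_eqI)
    fix d :: "bit ^ 'a"
    show "mc_coord d (x * y) = mc_coord d (y * x)"
      unfolding mc_coord_times
      by (rule sum.reindex_bij_witness[where i = "\<lambda>c. c + d" and j = "\<lambda>c. c + d"])
        (auto simp: add_ac mult_ac mc_sign_commute)
  qed
  show one: "1 * x = x" for x :: "'a multicomplex"
    by (rule mc_eqI) (simp add: mc_coord_times mc_coord_1 if_distrib if_distribR cong: if_cong)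
  then show "x * 1 = x"
    by (subst comm)
  show dist: "(x + y) * z = x * z + y * z" for x y z :: "'a multicomplex"
    by (rule mc_eqI) (simp add: mc_coord_times algebra_simps sum.distrib)
  show "x * (y + z) = x * y + x * z"
    by (simp only: comm[of x] dist)
  show "(0 :: 'a multicomplex) \<noteq> 1"
    by (metis mc_coord_1 mc_coord_simps(1) zero_neq_one)
  show "r *\<^sub>R x * y = r *\<^sub>R (x * y)" "x * r *\<^sub>R y = r *\<^sub>R (x * y)"
    by (rule mc_eqI; simp add: mc_coord_times sum_distrib_left mult_ac)+
qed
end

definition mc_unit :: "'n::finite \<Rightarrow> 'n multicomplex"
  where "mc_unit k = Mc (axis (axis k 1) 1)"

definition mc_monomial :: "bit ^ 'n::finite \<Rightarrow> 'n multicomplex"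
  where "mc_monomial b = (\<Prod>k\<in>UNIV. mc_unit k ^ of_bit (b $ k))"

text \<open>The set \<open>I(n)\<close>.\<close>

definition mc_monomials :: "'n::finite multicomplex set"
  where "mc_monomials = range mc_monomial"

lemma mc_axis_times:
  "Mc (axis a 1) * Mc (axis c 1) = mc_sign a c *\<^sub>R Mc (axis (a + c) (1::real))"
proof (rule mc_eqI)
  fix d :: "bit ^ 'a"
  have coord: "mc_coord b (Mc (axis a 1)) = (if b = a then 1 else 0)" for a b :: "bit ^ 'a"
    by (simp add: axis_def)
  have eq: "a + d = c \<longleftrightarrow> d = a + c"
    by (metis bit_vec_add_self2)
  have "mc_coord d (Mc (axis a 1) * Mc (axis c 1)) =
      (\<Sum>b\<in>UNIV. if b = a then (if a + d = c then mc_sign a c else 0) else 0)"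
    unfolding mc_coord_times coord by (rule sum.cong) auto
  also have "\<dots> = mc_coord d (mc_sign a c *\<^sub>R Mc (axis (a + c) (1::real)))"
    unfolding eq mc_coord_simps coord by simp
  finally show "mc_coord d (Mc (axis a 1) * Mc (axis c 1)) =
      mc_coord d (mc_sign a c *\<^sub>R Mc (axis (a + c) (1::real)))" .
qed

lemma mc_coord_times_axis:
  "mc_coord d (x * Mc (axis c 1)) = mc_sign (c + d) c * mc_coord (c + d) x"
proof -
  have eq: "a + d = c \<longleftrightarrow> a = c + d" for a
    by (metis add.commute bit_vec_add_self2)
  have "mc_coord d (x * Mc (axis c 1)) =
      (\<Sum>a\<in>UNIV. if a + d = c then mc_sign a c * mc_coord a x else 0)"
    unfolding mc_coord_times by (rule sum.cong) (auto simp: axis_def)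
  then show ?thesis
    unfolding eq by simp
qed

lemma mc_unit_square: "mc_unit k * mc_unit k = -1"
proof -
  have "mc_sign (axis k 1) (axis k 1) = (\<Prod>j\<in>UNIV. if j = k then -1 else 1)"
    unfolding mc_sign_def by (rule prod.cong) (auto simp: axis_def)
  then have "mc_sign (axis k 1) (axis k 1) = -1"
    by simp
  then show ?thesis
    by (simp add: mc_unit_def mc_axis_times) (simp add: one_multicomplex_def)
qed

lemma mc_monomial_eq: "mc_monomial b = Mc (axis b 1)"
proof -
  have "(\<Prod>k\<in>A. mc_unit k ^ of_bit (b $ k)) = Mc (axis (\<chi> k. if k \<in> A then b $ k else 0) 1)"
    if "finite A" for A
    using that
  proof induction
    case empty
    have "(\<chi> k. 0) = (0 :: bit ^ 'a)"
      by (simp add: vec_eq_iff)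
    then show ?case
      by (simp add: one_multicomplex_def)
  next
    case (insert j A)
    let ?r = "\<lambda>A. \<chi> k. if k \<in> A then b $ k else 0"
    show ?case
    proof (cases "b $ j = 0")
      case True
      then have "?r (insert j A) = ?r A"
        by (auto simp: vec_eq_iff)
      with True insert show ?thesis
        by simp
    next
      case False
      then have b: "b $ j = 1"
        by simp
      have r: "axis j 1 + ?r A = ?r (insert j A)"
        using b insert.hyps by (auto simp: vec_eq_iff axis_def)
      have "mc_sign (axis j 1) (?r A) = 1"
        unfolding mc_sign_def by (rule prod.neutral) (use insert.hyps in \<open>auto simp: axis_def\<close>)
      with insert b r show ?thesis
        by (simp add: mc_unit_def mc_axis_times)
    qed
  qed
  from this[of UNIV] show ?thesis
    by (simp add: mc_monomial_def)
qed

lemma mc_coord_monomial: "mc_coord b (mc_monomial c) = (if b = c then 1 else 0)"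
  by (simp add: mc_monomial_eq axis_def)

lemma mc_expansion: "x = (\<Sum>b\<in>UNIV. mc_coord b x *\<^sub>R mc_monomial b)"
  by (rule mc_eqI) (simp add: mc_coord_monomial if_distrib cong: if_cong)

lemma mc_expansion_unique:
  "(\<Sum>b\<in>UNIV. c b *\<^sub>R mc_monomial b) = x \<longleftrightarrow> c = (\<lambda>b. mc_coord b x)"
  by (auto simp: mc_eq_iff fun_eq_iff mc_coord_monomial if_distrib cong: if_cong)

lemma Basis_mc_monomials: "Basis = mc_monomials"
  by (simp add: Basis_multicomplex_def mc_monomials_def mc_monomial_eq)

lemma mc_inner_monomial: "inner x (mc_monomial b) = mc_coord b x"
  by (simp add: mc_monomial_eq inner_multicomplex_def inner_axis mc_coord_def)


subsection \<open>The recursive construction\<close>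

lemma mc_rec_base:
  fixes z :: "'n::finite multicomplex"
  assumes "CARD('n) = 1"
  shows "\<exists>!p :: real \<times> real. z = of_real (fst p) + of_real (snd p) * mc_unit k"
proof -
  have k: "j = k" for j :: 'n
    using assms by (metis UNIV_I card_1_singletonE singletonD)
  have b01: "b = 0 \<or> b = axis k 1" for b :: "bit ^ 'n"
  proof -
    have "b = 0" if "b $ k = 0"
      using that k by (metis vec_eq_iff zero_index)
    moreover have "b = axis k 1" if "b $ k = 1"
      using that k by (metis vec_eq_iff axis_nth)
    ultimately show ?thesis
      using bit.exhaust by blast
  qed
  have ne: "(0 :: bit ^ 'n) \<noteq> axis k 1"
    by (metis axis_eq_0_iff zero_neq_one)
  have coord_unit: "mc_coord b (mc_unit k) = (if b = axis k 1 then 1 else 0)" for b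
    by (simp add: mc_unit_def axis_def)
  have "z = of_real x + of_real y * mc_unit k \<longleftrightarrow> x = mc_coord 0 z \<and> y = mc_coord (axis k 1) z"
    for x y
  proof -
    have "(\<forall>b. P b) \<longleftrightarrow> P 0 \<and> P (axis k 1)" for P :: "bit ^ 'n \<Rightarrow> bool"
      using b01 by metis
    then show ?thesis
      using ne ne[symmetric]
      by (auto simp: mc_eq_iff of_real_def mc_coord_1 coord_unit)
  qed
  then show ?thesis
    by (auto intro!: ex1I[of _ "(mc_coord 0 z, mc_coord (axis k 1) z)"])
qed

definition mc_embed :: "'n::finite multicomplex \<Rightarrow> 'n option multicomplex"
  where "mc_embed x = Mc (\<chi> b. if b $ None = 0 then mc_coord (\<chi> k. b $ Some k) x else 0)"

definition opt_vec :: "bit \<Rightarrow> bit ^ 'n::finite \<Rightarrow> bit ^ 'n option"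
  where "opt_vec e b = (\<chi> j. case j of None \<Rightarrow> e | Some k \<Rightarrow> b $ k)"

lemma opt_vec_nth [simp]: "opt_vec e b $ None = e" "opt_vec e b $ Some k = b $ k"
  by (simp_all add: opt_vec_def)

lemma opt_vec_cases: obtains e b where "v = opt_vec e b"
proof
  show "v = opt_vec (v $ None) (\<chi> k. v $ Some k)"
    by (simp add: opt_vec_def vec_eq_iff split: option.split)
qed

lemma opt_vec_inject [simp]: "opt_vec e b = opt_vec e' b' \<longleftrightarrow> e = e' \<and> b = b'"
proof
  assume "opt_vec e b = opt_vec e' b'"
  then have "opt_vec e b $ j = opt_vec e' b' $ j" for j
    by simp
  from this[of None] this[of "Some _"] show "e = e' \<and> b = b'"
    by (simp add: vec_eq_iff)
qed simp

lemma opt_vec_add: "opt_vec e b + opt_vec e' b' = opt_vec (e + e') (b + b')"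
  by (simp add: opt_vec_def vec_eq_iff split: option.split)

lemma opt_vec_0: "opt_vec 0 0 = 0"
  by (simp add: opt_vec_def vec_eq_iff split: option.split)

lemma sum_opt_vec:
  fixes f :: "bit ^ 'n::finite option \<Rightarrow> real"
  shows "(\<Sum>v\<in>UNIV. f v) = (\<Sum>b\<in>UNIV. f (opt_vec 0 b)) + (\<Sum>b\<in>UNIV. f (opt_vec 1 b))"
proof -
  have U: "(UNIV :: (bit ^ 'n option) set) = range (opt_vec 0) \<union> range (opt_vec 1)"
  proof -
    have "v \<in> range (opt_vec 0) \<union> range (opt_vec 1)" for v :: "bit ^ 'n option"
    proof (rule opt_vec_cases[of v])
      show "v \<in> range (opt_vec 0) \<union> range (opt_vec 1)" if "v = opt_vec e b" for e b
        using that by (cases e) auto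
    qed
    then show ?thesis
      by blast
  qed
  have "(\<Sum>v\<in>UNIV. f v) = sum f (range (opt_vec 0)) + sum f (range (opt_vec 1))"
    unfolding U by (rule sum.union_disjoint) auto
  then show ?thesis
    by (simp add: sum.reindex inj_on_def)
qed

lemma mc_sign_opt_vec:
  "mc_sign (opt_vec e b) (opt_vec e' b') = (if e = 1 \<and> e' = 1 then -1 else 1) * mc_sign b b'"
proof -
  have "mc_sign (opt_vec e b) (opt_vec e' b') =
      (\<Prod>j\<in>insert None (range Some). if opt_vec e b $ j = 1 \<and> opt_vec e' b' $ j = 1 then -1 else 1)"
    unfolding mc_sign_def UNIV_option_conv ..
  also have "\<dots> = (if e = 1 \<and> e' = 1 then -1 else 1) * mc_sign b b'"
    by (subst prod.insert) (auto simp: mc_sign_def prod.reindex)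
  finally show ?thesis .
qed

lemma mc_coord_embed: "mc_coord (opt_vec e b) (mc_embed x) = (if e = 0 then mc_coord b x else 0)"
  by (simp add: mc_embed_def)

lemma mc_eq_iff_opt: "x = y \<longleftrightarrow> (\<forall>e b. mc_coord (opt_vec e b) x = mc_coord (opt_vec e b) y)"
  by (metis mc_eq_iff opt_vec_cases)

text \<open>
  \<open>mc_embed\<close> is an injective algebra homomorphism respecting the units; every element of
  the larger algebra is uniquely \<open>x + y i\<close> with \<open>x, y\<close> in its image and \<open>i\<close> the new unit.
\<close>

lemma mc_rec_embed_hom:
  "mc_embed (x + y) = mc_embed x + mc_embed y"
  "mc_embed (r *\<^sub>R x) = r *\<^sub>R mc_embed x"
  "mc_embed (x * y) = mc_embed x * mc_embed y"
  "mc_embed 1 = 1"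
  "mc_embed (mc_unit k) = mc_unit (Some k)"
proof -
  show "mc_embed (x + y) = mc_embed x + mc_embed y" "mc_embed (r *\<^sub>R x) = r *\<^sub>R mc_embed x"
    by (simp_all add: mc_eq_iff_opt mc_coord_embed)
  show "mc_embed (x * y) = mc_embed x * mc_embed y"
    by (auto simp: mc_eq_iff_opt mc_coord_embed mc_coord_times sum_opt_vec opt_vec_add
        mc_sign_opt_vec)
  show "mc_embed 1 = 1"
    by (simp add: mc_eq_iff_opt mc_coord_embed mc_coord_1 flip: opt_vec_0)
  have "axis (Some k) 1 = opt_vec 0 (axis k 1)"
    by (simp add: opt_vec_def axis_def vec_eq_iff split: option.split)
  then show "mc_embed (mc_unit k) = mc_unit (Some k)"
    by (simp add: mc_eq_iff_opt mc_coord_embed mc_unit_def axis_def)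
qed

lemma mc_rec_step:
  fixes z :: "'n::finite option multicomplex"
  shows "\<exists>!p. z = mc_embed (fst p) + mc_embed (snd p) * mc_unit None"
proof -
  have u: "mc_unit (None :: 'n option) = Mc (axis (opt_vec 1 0) 1)"
  proof -
    have "axis None 1 = opt_vec 1 (0 :: bit ^ 'n)"
      by (simp add: opt_vec_def axis_def vec_eq_iff split: option.split)
    then show ?thesis
      by (simp add: mc_unit_def)
  qed
  have c: "mc_coord (opt_vec e b) (mc_embed y * mc_unit None) = (if e = 1 then mc_coord b y else 0)"
    for e b and y :: "'n multicomplex"
  proof -
    have "opt_vec 1 0 + opt_vec e b = opt_vec (1 + e) b"
      by (simp add: opt_vec_add)
    then show ?thesis
      unfolding u mc_coord_times_axis by (cases e) (simp_all add: mc_coord_embed mc_sign_opt_vec)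
  qed
  let ?p = "(Mc (\<chi> b. mc_coord (opt_vec 0 b) z), Mc (\<chi> b. mc_coord (opt_vec 1 b) z))"
  have "z = mc_embed x + mc_embed y * mc_unit None \<longleftrightarrow> (x, y) = ?p" for x y
  proof -
    have "z = mc_embed x + mc_embed y * mc_unit None \<longleftrightarrow>
        (\<forall>e b. mc_coord (opt_vec e b) z = (if e = 0 then mc_coord b x else mc_coord b y))"
      unfolding mc_eq_iff_opt[of z] by (simp add: mc_coord_embed c) blast
    also have "\<dots> \<longleftrightarrow> (\<forall>b. mc_coord (opt_vec 0 b) z = mc_coord b x) \<and>
        (\<forall>b. mc_coord (opt_vec 1 b) z = mc_coord b y)"
    proof -
      have "(\<forall>e. P e) \<longleftrightarrow> P 0 \<and> P 1" for P :: "bit \<Rightarrow> bool"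
        using bit.exhaust by metis
      from this[of "\<lambda>e. \<forall>b. mc_coord (opt_vec e b) z = (if e = 0 then mc_coord b x else mc_coord b y)"]
      show ?thesis
        by simp
    qed
    also have "\<dots> \<longleftrightarrow> (x, y) = ?p"
      unfolding prod.inject mc_eq_iff mc_coord_Mc vec_lambda_beta by metis
    finally show ?thesis .
  qed
  then have *: "z = mc_embed (fst p) + mc_embed (snd p) * mc_unit None \<longleftrightarrow> p = ?p" for p
    by (metis prod.collapse)
  show ?thesis
    unfolding * by (rule ex1I[of _ ?p]) auto
qed


subsection \<open>Holomorphy and harmonicity\<close>

text \<open>
  The domain of these predicates is meant to be open; a function on \<open>U\<close> is represented by
  any total function extending it, whose values outside \<open>U\<close> are then irrelevant.
\<close>

definition C1_on :: "'a::real_normed_vector set \<Rightarrow> ('a \<Rightarrow> 'b::real_normed_vector) \<Rightarrow> bool"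
  where "C1_on U f \<longleftrightarrow> (\<exists>f' :: 'a \<Rightarrow> 'a \<Rightarrow>\<^sub>L 'b.
    (\<forall>x\<in>U. (f has_derivative blinfun_apply (f' x)) (at x)) \<and> continuous_on U f')"

definition C2_on :: "'a::real_normed_vector set \<Rightarrow> ('a \<Rightarrow> 'b::real_normed_vector) \<Rightarrow> bool"
  where "C2_on U f \<longleftrightarrow> (\<exists>f' :: 'a \<Rightarrow> 'a \<Rightarrow>\<^sub>L 'b.
    (\<forall>x\<in>U. (f has_derivative blinfun_apply (f' x)) (at x)) \<and> C1_on U f')"

definition mc_mult :: "'n::finite multicomplex \<Rightarrow> 'n multicomplex \<Rightarrow> 'n multicomplex"
  where "mc_mult i = (\<lambda>x. i * x)"

definition Hol :: "'n::finite multicomplex \<Rightarrow> 'n multicomplex set \<Rightarrow>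
    ('n multicomplex \<Rightarrow> 'n multicomplex) set"
  where "Hol i U = {F. C1_on U F \<and>
    (\<forall>x\<in>U. frechet_derivative F (at x) \<circ> mc_mult i = mc_mult i \<circ> frechet_derivative F (at x))}"

definition antiHol :: "'n::finite multicomplex \<Rightarrow> 'n multicomplex set \<Rightarrow>
    ('n multicomplex \<Rightarrow> 'n multicomplex) set"
  where "antiHol i U = {F. C1_on U F \<and>
    (\<forall>x\<in>U. frechet_derivative F (at x) \<circ> mc_mult i =
      (\<lambda>h. - (mc_mult i \<circ> frechet_derivative F (at x)) h))}"

definition mc_partial :: "bit ^ 'n::finite \<Rightarrow> ('n multicomplex \<Rightarrow> 'b::real_normed_vector) \<Rightarrow>
    'n multicomplex \<Rightarrow> 'b"
  where "mc_partial b F x = vector_derivative (\<lambda>t. F (x + t *\<^sub>R mc_monomial b)) (at 0)"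

definition mc_laplacian :: "('n::finite multicomplex \<Rightarrow> 'b::real_normed_vector) \<Rightarrow>
    'n multicomplex \<Rightarrow> 'b"
  where "mc_laplacian F x = (\<Sum>b\<in>UNIV. mc_partial b (mc_partial b F) x)"

text \<open>
  The regularity \<open>C2_on\<close> guarantees that the derivatives in \<open>mc_laplacian\<close> exist, which
  the total operator \<open>vector_derivative\<close> does not.
\<close>

definition mc_harmonic_on :: "'n::finite multicomplex set \<Rightarrow>
    ('n multicomplex \<Rightarrow> 'b::real_normed_vector) \<Rightarrow> bool"
  where "mc_harmonic_on U F \<longleftrightarrow> C2_on U F \<and> (\<forall>x\<in>U. mc_laplacian F x = 0)"

end

theory Submission
  imports Defs "HOL-Complex_Analysis.Cauchy_Integral_Formula"
begin

text \<open>
  Multiplication by \<open>i\<close> makes \<open>MC(n)\<close> a complex vector space, and \<open>F\<close> is a holomorphic map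
  between complex vector spaces once the values are given the complex structure \<open>K\<close> which is
  multiplication by \<open>i\<close> in the holomorphic and by \<open>-i\<close> in the antiholomorphic case:
  both hypotheses say \<open>DF(x) (i h) = K (DF(x) h)\<close> with \<open>K \<circ> K = -id\<close>.  Two things then have
  to be shown.

  Regularity: \<open>F\<close> is only assumed \<open>C^1\<close>, so the second derivatives must be produced.  On the
  complex line through \<open>x\<close> spanned by \<open>h\<close>, Cauchy's formula expresses the directional derivative
  \<open>DF(x) h\<close> as a circle integral of translates of \<open>F\<close>.  The integrand is \<open>C^1\<close> in \<open>x\<close>, so
  differentiation under the integral shows that \<open>x \<mapsto> DF(x) h\<close> is \<open>C^1\<close>, and that it satisfies
  the same Cauchy-Riemann equation as \<open>F\<close>
  (\<open>Hol_between_directional_derivative\<close>, reduced to complex-valued functions by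
  complex-linear functionals).

  Cancellation: writing \<open>S(h, k)\<close> for the second derivative of \<open>F\<close> at \<open>x\<close>, the Cauchy-Riemann
  equations for \<open>F\<close> and for \<open>DF(\<cdot>) h\<close> let \<open>i\<close> be pulled out of either argument of \<open>S\<close>, so that
  \<open>S(i h, i h) = K (K (S(h, h))) = - S(h, h)\<close> (\<open>Hol_between_second_derivative\<close>).  Since
  multiplication by the monomial \<open>i\<close> permutes the monomial basis up to signs, and signs do not
  affect \<open>S(h, h)\<close>, replacing every basis vector \<open>e\<close> by \<open>i e\<close> leaves the Laplacian
  \<open>\<Sum> S(e, e)\<close> unchanged; it therefore equals its own negative
  (\<open>Hol_between_mc_harmonic_on\<close>).
\<close>

section \<open>Continuously differentiable maps\<close>

lemma C1_onE:
  assumes "C1_on U f"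
  obtains f' where "\<And>x. x \<in> U \<Longrightarrow> (f has_derivative blinfun_apply (f' x)) (at x)"
    and "continuous_on U f'"
    and "\<And>x. x \<in> U \<Longrightarrow> frechet_derivative f (at x) = blinfun_apply (f' x)"
  using assms unfolding C1_on_def by (metis frechet_derivative_at)

lemma C1_on_has_derivative:
  assumes "C1_on U f" "x \<in> U"
  shows "(f has_derivative frechet_derivative f (at x)) (at x)"
  using assms by (metis C1_onE)

lemma C1_onI:
  assumes "\<And>x. x \<in> U \<Longrightarrow> (f has_derivative blinfun_apply (f' x)) (at x)" "continuous_on U f'"
  shows "C1_on U f"
  using assms unfolding C1_on_def by blast

lemma C2_onE:
  assumes "C2_on U f"
  obtains f' where "\<And>x. x \<in> U \<Longrightarrow> (f has_derivative blinfun_apply (f' x)) (at x)"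
    and "C1_on U f'"
  using assms unfolding C2_on_def by metis

lemma C2_onI:
  assumes "\<And>x. x \<in> U \<Longrightarrow> (f has_derivative blinfun_apply (f' x)) (at x)" "C1_on U f'"
  shows "C2_on U f"
  unfolding C2_on_def using assms by (intro exI[of _ f']) simp

text \<open>
  Cauchy's formula gives a derivative only on balls whose radius varies with the centre.  By
  uniqueness of derivatives the local ones agree with the globally defined
  \<open>frechet_derivative\<close>, so no choices have to be glued.
\<close>

lemma C1_on_local:
  assumes "\<And>x. x \<in> U \<Longrightarrow> \<exists>V. open V \<and> x \<in> V \<and> C1_on V f"
  shows "C1_on U f"
proof (rule C1_onI)
  let ?D = "\<lambda>x. Blinfun (frechet_derivative f (at x))"
  have *: "(f has_derivative blinfun_apply (?D x)) (at x) \<and> continuous (at x) ?D"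
    if x: "x \<in> U" for x
  proof -
    obtain V where V: "open V" "x \<in> V" "C1_on V f"
      using assms[OF x] by (elim exE conjE)
    obtain f' where f': "\<And>x. x \<in> V \<Longrightarrow> (f has_derivative blinfun_apply (f' x)) (at x)"
        "continuous_on V f'" "\<And>x. x \<in> V \<Longrightarrow> frechet_derivative f (at x) = blinfun_apply (f' x)"
      using V(3) by (rule C1_onE) blast
    have eq: "?D y = f' y" if "y \<in> V" for y
      using f'(3)[OF that] by (simp add: blinfun_apply_inverse)
    have "continuous_on V ?D"
      using f'(2) by (simp cong: continuous_on_cong add: eq)
    then have "continuous (at x) ?D"
      by (rule continuous_on_eq_continuous_at[THEN iffD1, OF V(1), THEN bspec, OF _ V(2)])
    moreover have "(f has_derivative blinfun_apply (?D x)) (at x)"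
      using f'(1)[OF V(2)] by (simp only: eq[OF V(2)])
    ultimately show ?thesis
      by (rule conjI[rotated])
  qed
  show "(f has_derivative blinfun_apply (?D x)) (at x)" if "x \<in> U" for x
    using * that by blast
  show "continuous_on U ?D"
    using * by (blast intro: continuous_at_imp_continuous_on)
qed

lemma C1_on_cong:
  assumes "open U" "C1_on U f" "\<And>x. x \<in> U \<Longrightarrow> f x = g x"
  shows "C1_on U g"
  using assms(2)
proof (rule C1_onE)
  fix f' assume f': "\<And>x. x \<in> U \<Longrightarrow> (f has_derivative blinfun_apply (f' x)) (at x)"
    "continuous_on U f'"
  show "C1_on U g"
  proof (rule C1_onI[OF _ f'(2)])
    show "(g has_derivative blinfun_apply (f' x)) (at x)" if "x \<in> U" for x
      using f'(1)[OF that] assms(1) that assms(3) by (rule has_derivative_transform_within_open)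
  qed
qed

lemma C1_on_bounded_linear:
  assumes "bounded_linear T" "C1_on U f"
  shows "C1_on U (\<lambda>x. T (f x))"
  using assms(2)
proof (rule C1_onE)
  fix f' assume f': "\<And>x. x \<in> U \<Longrightarrow> (f has_derivative blinfun_apply (f' x)) (at x)"
    "continuous_on U f'"
  have T: "blinfun_apply (Blinfun T) = T"
    using assms(1) by (rule bounded_linear_Blinfun_apply)
  show ?thesis
  proof (rule C1_onI)
    show "((\<lambda>x. T (f x)) has_derivative blinfun_apply (Blinfun T o\<^sub>L f' x)) (at x)" if "x \<in> U" for x
      using bounded_linear.has_derivative[OF assms(1) f'(1)[OF that]]
      by (simp add: T blinfun_compose.rep_eq comp_def)
    show "continuous_on U (\<lambda>x. Blinfun T o\<^sub>L f' x)"
      by (intro continuous_intros f'(2))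
  qed
qed

lemma frechet_derivative_bounded_linear:
  assumes "bounded_linear T" "C1_on U f" "x \<in> U"
  shows "frechet_derivative (\<lambda>x. T (f x)) (at x) h = T (frechet_derivative f (at x) h)"
  using bounded_linear.has_derivative[OF assms(1) C1_on_has_derivative[OF assms(2,3)]]
  by (metis frechet_derivative_at)

lemma C1_on_sum:
  assumes "\<And>i. i \<in> I \<Longrightarrow> C1_on U (f i)"
  shows "C1_on U (\<lambda>x. \<Sum>i\<in>I. f i x)"
proof -
  have "\<forall>i. \<exists>f'. i \<in> I \<longrightarrow> (\<forall>x\<in>U. (f i has_derivative blinfun_apply (f' x)) (at x)) \<and> continuous_on U f'"
    using assms unfolding C1_on_def by blast
  then obtain f' where
    f': "\<And>i x. i \<in> I \<Longrightarrow> x \<in> U \<Longrightarrow> (f i has_derivative blinfun_apply (f' i x)) (at x)"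
      "\<And>i. i \<in> I \<Longrightarrow> continuous_on U (f' i)"
    by metis
  show ?thesis
  proof (rule C1_onI)
    show "((\<lambda>x. \<Sum>i\<in>I. f i x) has_derivative blinfun_apply (\<Sum>i\<in>I. f' i x)) (at x)"
      if "x \<in> U" for x
      by (rule has_derivative_eq_rhs[OF has_derivative_sum[OF f'(1)]])
        (auto simp: blinfun.sum_left that)
    show "continuous_on U (\<lambda>x. \<Sum>i\<in>I. f' i x)"
      by (intro continuous_on_sum f'(2))
  qed
qed

lemma C2_on_bounded_linear:
  assumes "bounded_linear T" "C2_on U f"
  shows "C2_on U (\<lambda>x. T (f x))"
proof -
  obtain f' where f': "\<And>x. x \<in> U \<Longrightarrow> (f has_derivative blinfun_apply (f' x)) (at x)" "C1_on U f'"
    using assms(2) by (rule C2_onE) blast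
  have T: "blinfun_apply (Blinfun T) = T"
    using assms(1) by (rule bounded_linear_Blinfun_apply)
  have "((\<lambda>x. T (f x)) has_derivative blinfun_apply (Blinfun T o\<^sub>L f' x)) (at x)" if "x \<in> U" for x
    using bounded_linear.has_derivative[OF assms(1) f'(1)[OF that]]
    by (simp add: T blinfun_compose.rep_eq comp_def)
  moreover have "C1_on U (\<lambda>x. Blinfun T o\<^sub>L f' x)"
    by (rule C1_on_bounded_linear[OF _ f'(2)])
      (rule bounded_bilinear.bounded_linear_right[OF bounded_bilinear_blinfun_compose])
  ultimately show ?thesis
    by (rule C2_onI)
qed

lemma C2_on_imp_C1_on:
  assumes "C2_on U f"
  shows "C1_on U f"
proof -
  obtain f' where f': "\<And>x. x \<in> U \<Longrightarrow> (f has_derivative blinfun_apply (f' x)) (at x)" "C1_on U f'"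
    using assms by (rule C2_onE) blast
  have "continuous_on U f'"
    by (rule has_derivative_continuous_on)
      (use C1_on_has_derivative[OF f'(2)] has_derivative_at_withinI in blast)
  with f'(1) show ?thesis
    by (rule C1_onI)
qed

lemma C2_on_imp_C1_on_directional:
  assumes "C2_on U f" "open U"
  shows "C1_on U (\<lambda>x. frechet_derivative f (at x) h)"
proof -
  obtain f' where f': "\<And>x. x \<in> U \<Longrightarrow> (f has_derivative blinfun_apply (f' x)) (at x)" "C1_on U f'"
    using assms(1) by (rule C2_onE) blast
  have "f' x h = frechet_derivative f (at x) h" if "x \<in> U" for x
    using f'(1)[OF that] by (metis frechet_derivative_at)
  with assms(2) C1_on_bounded_linear[OF blinfun.bounded_linear_left f'(2), of h] show ?thesis
    by (rule C1_on_cong)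
qed

text \<open>
  The derivative is the finite sum of the rank-one maps \<open>k \<mapsto> (k \<bullet> h) *\<^sub>R Df(x) h\<close> over the basis
  vectors \<open>h\<close>, each of which depends linearly on \<open>Df(x) h\<close>.
\<close>

lemma C2_onI_directional:
  fixes f :: "'a::euclidean_space \<Rightarrow> 'b::real_normed_vector"
  assumes "C1_on U f" "open U"
    and "\<And>h. h \<in> Basis \<Longrightarrow> C1_on U (\<lambda>x. frechet_derivative f (at x) h)"
  shows "C2_on U f"
  using assms(1)
proof (rule C1_onE)
  fix f' assume f': "\<And>x. x \<in> U \<Longrightarrow> (f has_derivative blinfun_apply (f' x)) (at x)"
    "\<And>x. x \<in> U \<Longrightarrow> frechet_derivative f (at x) = blinfun_apply (f' x)"
  let ?B = "\<lambda>h v. blinfun_scaleR_left v o\<^sub>L blinfun_inner_left h"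
  have "C1_on U (\<lambda>x. \<Sum>h\<in>Basis. ?B h (frechet_derivative f (at x) h))"
  proof (rule C1_on_sum)
    fix h :: 'a assume h: "h \<in> Basis"
    have "bounded_linear (?B h)"
      by (rule bounded_linear_compose
          [OF bounded_bilinear.bounded_linear_left[OF bounded_bilinear_blinfun_compose]
            bounded_linear_blinfun_scaleR_left])
    then show "C1_on U (\<lambda>x. ?B h (frechet_derivative f (at x) h))"
      using assms(3)[OF h] by (rule C1_on_bounded_linear)
  qed
  moreover have "(\<Sum>h\<in>Basis. ?B h (frechet_derivative f (at x) h)) = f' x" if "x \<in> U" for x
  proof (rule blinfun_eqI)
    fix k
    have "f' x k = f' x (\<Sum>h\<in>Basis. (k \<bullet> h) *\<^sub>R h)"
      by (simp add: euclidean_representation)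
    then show "(\<Sum>h\<in>Basis. ?B h (frechet_derivative f (at x) h)) k = f' x k"
      using f'(2)[OF that] by (simp add: blinfun.sum_left blinfun.sum_right blinfun.scaleR_right)
  qed
  ultimately have "C1_on U f'"
    using C1_on_cong[OF assms(2)] by blast
  with f'(1) show ?thesis
    by (rule C2_onI)
qed

section \<open>Derivatives of holomorphic maps are holomorphic\<close>

text \<open>
  This is Leibniz' rule for a weighted average of translates.  The explicit derivative is needed,
  besides differentiability, because an equation such as \<open>f' y (J k) = \<i> * f' y k\<close> passes to the
  average through it.
\<close>

lemma
  fixes f :: "'a::euclidean_space \<Rightarrow> complex" and f' :: "'a \<Rightarrow> 'a \<Rightarrow>\<^sub>L complex"
    and c :: "real \<Rightarrow> complex" and v :: "real \<Rightarrow> 'a"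
  assumes f: "\<And>x. x \<in> U \<Longrightarrow> (f has_derivative blinfun_apply (f' x)) (at x)" "continuous_on U f'"
    and V: "open V" "convex V"
    and c: "continuous_on {a..b} c" and v: "continuous_on {a..b} v"
    and sub: "\<And>x t. x \<in> V \<Longrightarrow> t \<in> {a..b} \<Longrightarrow> x + v t \<in> U"
  shows C1_on_integral_translates: "C1_on V (\<lambda>x. integral {a..b} (\<lambda>t. c t * f (x + v t)))"
    and frechet_derivative_integral_translates: "x \<in> V \<Longrightarrow>
      frechet_derivative (\<lambda>x. integral {a..b} (\<lambda>t. c t * f (x + v t))) (at x) h =
        integral {a..b} (\<lambda>t. c t * f' (x + v t) h)"
proof -
  let ?F = "\<lambda>x. integral {a..b} (\<lambda>t. c t * f (x + v t))"
  let ?k = "\<lambda>x t. blinfun_mult_right (c t) o\<^sub>L f' (x + v t)"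
  have cont_f: "continuous_on U f"
    by (rule has_derivative_continuous_on) (use f(1) has_derivative_at_withinI in blast)
  have cont_k: "continuous_on (V \<times> {a..b}) (\<lambda>(x, t). ?k x t)"
    unfolding split_beta
    by (intro continuous_intros continuous_on_compose2[OF f(2)] continuous_on_compose2[OF c]
        continuous_on_compose2[OF v]) (auto simp: sub)
  have der: "(?F has_derivative blinfun_apply (integral {a..b} (?k x))) (at x)" if "x \<in> V" for x
  proof -
    have "(?F has_derivative blinfun_apply (integral (cbox a b) (?k x))) (at x within V)"
      unfolding cbox_interval[symmetric]
    proof (rule leibniz_rule[OF _ _ _ that V(2)])
      fix y t assume y: "y \<in> V" and t: "t \<in> cbox a b"
      have "(f has_derivative blinfun_apply (f' (y + v t))) (at (y + v t))"
        using f(1) sub y t by simp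
      then have "((\<lambda>y. f (y + v t)) has_derivative blinfun_apply (f' (y + v t))) (at y within V)"
        by (rule has_derivative_compose[rotated, of _ _ "\<lambda>y. y + v t"])
          (auto intro!: derivative_eq_intros)
      then show "((\<lambda>y. c t * f (y + v t)) has_derivative blinfun_apply (?k y t)) (at y within V)"
        by (auto intro!: derivative_eq_intros simp: blinfun_compose.rep_eq comp_def)
    next
      fix y assume "y \<in> V"
      then show "(\<lambda>t. c t * f (y + v t)) integrable_on cbox a b"
        by (intro integrable_continuous continuous_intros continuous_on_compose2[OF cont_f])
          (auto simp: sub c v)
    next
      show "continuous_on (V \<times> cbox a b) (\<lambda>(x, t). ?k x t)"
        using cont_k by simp
    qed
    then show ?thesis
      by (simp only: cbox_interval at_within_open[OF that V(1)])
  qed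
  have "continuous_on V (\<lambda>x. integral {a..b} (?k x))"
    using integral_continuous_on_param[of V a b ?k] cont_k by simp
  with der show "C1_on V ?F"
    by (rule C1_onI)
  assume x: "x \<in> V"
  have int: "?k x integrable_on {a..b}"
    by (intro integrable_continuous_real continuous_intros continuous_on_compose2[OF f(2)])
      (auto simp: sub c v x)
  have "frechet_derivative ?F (at x) h = integral {a..b} (?k x) h"
    by (simp only: frechet_derivative_at[OF der[OF x], symmetric])
  also have "\<dots> = integral {a..b} (\<lambda>t. c t * f' (x + v t) h)"
    using blinfun_apply_integral[OF int] by simp
  finally show "frechet_derivative ?F (at x) h = integral {a..b} (\<lambda>t. c t * f' (x + v t) h)" .
qed

text \<open>
  When \<open>J\<close> and \<open>K\<close> are linear with square \<open>-id\<close>, these are the holomorphic maps between the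
  complex vector spaces with scalar \<open>\<i>\<close> acting as \<open>J\<close> and \<open>K\<close>.
  Separate structures on source and target let antiholomorphic maps be treated as holomorphic
  ones, by replacing \<open>K\<close> with \<open>-K\<close>.
\<close>

definition Hol_between :: "('a::euclidean_space \<Rightarrow> 'a) \<Rightarrow> ('b::real_normed_vector \<Rightarrow> 'b) \<Rightarrow>
    'a set \<Rightarrow> ('a \<Rightarrow> 'b) set"
  where "Hol_between J K U = {F. C1_on U F \<and>
    (\<forall>x\<in>U. \<forall>h. frechet_derivative F (at x) (J h) = K (frechet_derivative F (at x) h))}"

text \<open>
  The Cauchy-Riemann equation in the directions \<open>h\<close>, \<open>k\<close> makes
  \<open>z \<mapsto> f (x + Re z h + Im z k)\<close> holomorphic on a disc with derivative \<open>f' x h\<close> at \<open>0\<close>, and the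
  identity is Cauchy's formula for that derivative on the circle of radius \<open>r\<close>: the kernel
  \<open>1 / (2 \<pi> \<i> z\<^sup>2)\<close> times the velocity \<open>2 \<pi> \<i> z\<close> of the circle leaves \<open>1 / z\<close>.
\<close>

lemma directional_derivative_circle_integral:
  fixes f :: "'a::real_normed_vector \<Rightarrow> complex" and f' :: "'a \<Rightarrow> 'a \<Rightarrow> complex"
  assumes f: "\<And>y. dist x y \<le> r * (norm h + norm k) \<Longrightarrow> (f has_derivative f' y) (at y)"
    and CR: "\<And>y. dist x y \<le> r * (norm h + norm k) \<Longrightarrow> f' y k = \<i> * f' y h"
    and r: "0 < r"
  shows "f' x h = integral {0..1} (\<lambda>t. 1 / (r * exp (2 * of_real pi * \<i> * t)) *
    f (x + (Re (circlepath 0 r t) *\<^sub>R h + Im (circlepath 0 r t) *\<^sub>R k)))"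
proof -
  define L where "L z = Re z *\<^sub>R h + Im z *\<^sub>R k" for z
  have near: "dist x (x + L z) \<le> r * (norm h + norm k)" if "z \<in> cball 0 r" for z
  proof -
    have "norm (L z) \<le> \<bar>Re z\<bar> * norm h + \<bar>Im z\<bar> * norm k"
      unfolding L_def by (rule norm_triangle_le) simp
    also have "\<dots> \<le> r * norm h + r * norm k"
      using that abs_Re_le_cmod[of z] abs_Im_le_cmod[of z]
      by (intro add_mono mult_right_mono) auto
    finally show ?thesis
      by (simp add: dist_norm distrib_left)
  qed
  have q: "((\<lambda>z. f (x + L z)) has_field_derivative f' (x + L z) h) (at z)"
    if "z \<in> cball 0 r" for z
  proof -
    have lin: "linear (f' (x + L z))"
      using f[OF near[OF that]] by (rule has_derivative_linear)
    have "f' (x + L z) (L w) = f' (x + L z) h * w" for w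
    proof -
      have "f' (x + L z) (L w) = Re w *\<^sub>R f' (x + L z) h + Im w *\<^sub>R (\<i> * f' (x + L z) h)"
        using CR[OF near[OF that]]
        by (simp add: L_def[of w] linear_add[OF lin] linear_scale[OF lin])
      also have "\<dots> = f' (x + L z) h * w"
        by (subst (3) complex_eq[of w]) (simp add: scaleR_conv_of_real algebra_simps)
      finally show ?thesis .
    qed
    moreover have "((\<lambda>z. f (x + L z)) has_derivative (\<lambda>w. f' (x + L z) (L w))) (at z)"
      by (rule has_derivative_compose[where f = "\<lambda>z. x + L z" and g = f, OF _ f[OF near[OF that]]])
        (auto simp: L_def intro!: derivative_eq_intros)
    ultimately show ?thesis
      by (simp add: has_field_derivative_def)
  qed
  have "((\<lambda>z. f (x + L z)) has_field_derivative (1 / (2 * of_real pi * \<i>) *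
      contour_integral (circlepath 0 r) (\<lambda>u. f (x + L u) / (u - 0)^2))) (at 0)"
  proof (rule Cauchy_derivative_integral_circlepath)
    show "continuous_on (cball 0 r) (\<lambda>z. f (x + L z))"
      using q by (intro continuous_at_imp_continuous_on ballI DERIV_isCont) blast
    show "(\<lambda>z. f (x + L z)) holomorphic_on ball 0 r"
      unfolding holomorphic_on_open[OF open_ball]
    proof
      fix z :: complex assume "z \<in> ball 0 r"
      then have "z \<in> cball 0 r"
        by simp
      then show "\<exists>D. ((\<lambda>z. f (x + L z)) has_field_derivative D) (at z)"
        using q by (intro exI)
    qed
  qed (use r in auto)
  moreover have "((\<lambda>z. f (x + L z)) has_field_derivative f' x h) (at 0)"
    using q[of 0] r by (simp add: L_def)
  ultimately have "f' x h = 1 / (2 * of_real pi * \<i>) *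
      contour_integral (circlepath 0 r) (\<lambda>u. f (x + L u) / (u - 0)^2)"
    by (rule DERIV_unique[rotated])
  also have "\<dots> = integral {0..1} (\<lambda>t. 1 / (2 * of_real pi * \<i>) *
      (f (x + L (circlepath 0 r t)) / (circlepath 0 r t - 0)^2 *
        vector_derivative (circlepath 0 r) (at t)))"
    unfolding contour_integral_integral by (rule integral_mult_right[symmetric])
  also have "\<dots> = integral {0..1} (\<lambda>t. 1 / (r * exp (2 * of_real pi * \<i> * t)) * f (x + L (circlepath 0 r t)))"
  proof (rule integral_cong)
    fix t :: real
    have "circlepath 0 r t = r * exp (2 * of_real pi * \<i> * t)"
      by (simp add: circlepath)
    then show "1 / (2 * of_real pi * \<i>) *
      (f (x + L (circlepath 0 r t)) / (circlepath 0 r t - 0)^2 *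
        vector_derivative (circlepath 0 r) (at t)) =
      1 / (r * exp (2 * of_real pi * \<i> * t)) * f (x + L (circlepath 0 r t))"
      using r by (simp add: vector_derivative_circlepath power2_eq_square field_simps)
  qed
  finally show ?thesis
    unfolding L_def .
qed

text \<open>
  Near a point of \<open>U\<close> the circle radius can be kept fixed, so the preceding two results apply:
  \<open>x \<mapsto> Df(x) h\<close> is an average of translates of \<open>f\<close>, hence \<open>C^1\<close> like \<open>f\<close>, and the
  Cauchy-Riemann equation, being linear in the derivative, is inherited by averages.
\<close>

lemma Hol_between_directional_derivative_complex:
  fixes f :: "'a::euclidean_space \<Rightarrow> complex"
  assumes f: "f \<in> Hol_between J ((*) \<i>) U" and U: "open U"
  shows "(\<lambda>x. frechet_derivative f (at x) h) \<in> Hol_between J ((*) \<i>) U"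
proof -
  let ?g = "\<lambda>x. frechet_derivative f (at x) h"
  have C1: "C1_on U f" and J: "\<And>x h. x \<in> U \<Longrightarrow>
      frechet_derivative f (at x) (J h) = \<i> * frechet_derivative f (at x) h"
    using f by (auto simp: Hol_between_def)
  obtain f' where f': "\<And>x. x \<in> U \<Longrightarrow> (f has_derivative blinfun_apply (f' x)) (at x)"
      "continuous_on U f'" "\<And>x. x \<in> U \<Longrightarrow> frechet_derivative f (at x) = blinfun_apply (f' x)"
    using C1 by (rule C1_onE) blast
  have local: "\<exists>V. open V \<and> x \<in> V \<and> C1_on V ?g \<and>
      (\<forall>k. frechet_derivative ?g (at x) (J k) = \<i> * frechet_derivative ?g (at x) k)"
    if x: "x \<in> U" for x
  proof -
    obtain d where d: "0 < d" "ball x d \<subseteq> U"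
      using U x open_contains_ball by blast
    define V where "V = ball x (d / 2)"
    \<comment> \<open>The summand \<open>1\<close> keeps the radius finite when \<open>h\<close> and \<open>J h\<close> vanish.\<close>
    define s where "s = norm h + norm (J h) + 1"
    define r where "r = d / 2 / s"
    have s: "0 < s"
      by (simp add: s_def add_nonneg_pos)
    have r: "0 < r" "r * (norm h + norm (J h)) < d / 2"
      using d(1) s by (simp_all add: r_def s_def field_simps)
    have sub: "z \<in> U" if "y \<in> V" "dist y z \<le> r * (norm h + norm (J h))" for y z
    proof -
      have "dist x z < d"
        using that r(2) dist_triangle[of x z y] unfolding V_def by simp
      then show ?thesis
        using d(2) by auto
    qed
    define v where "v t = Re (circlepath 0 r t) *\<^sub>R h + Im (circlepath 0 r t) *\<^sub>R J h" for t
    define c where "c t = 1 / (r * exp (2 * of_real pi * \<i> * of_real t))" for t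
    have v: "continuous_on {0..1} v"
      unfolding v_def circlepath by (intro continuous_intros)
    have c: "continuous_on {0..1} c"
      unfolding c_def using r(1) by (intro continuous_intros) auto
    have v_sub: "y + v t \<in> U" if "y \<in> V" for y t
    proof (rule sub[OF that])
      have "cmod (circlepath 0 r t) = r"
        using r(1) by (simp add: circlepath norm_mult)
      then have "\<bar>Re (circlepath 0 r t)\<bar> \<le> r" "\<bar>Im (circlepath 0 r t)\<bar> \<le> r"
        using abs_Re_le_cmod[of "circlepath 0 r t"] abs_Im_le_cmod[of "circlepath 0 r t"] by auto
      then have "norm (v t) \<le> r * norm h + r * norm (J h)"
        unfolding v_def
        by (intro norm_triangle_le) (simp add: add_mono mult_right_mono)
      then show "dist y (y + v t) \<le> r * (norm h + norm (J h))"
        by (simp add: dist_norm distrib_left)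
    qed
    let ?G = "\<lambda>y. integral {0..1} (\<lambda>t. c t * f (y + v t))"
    have V: "open V" "convex V" "x \<in> V" "V \<subseteq> U"
      using d by (auto simp: V_def)
    have eq: "?G y = ?g y" if "y \<in> V" for y
      unfolding c_def v_def
    proof (rule directional_derivative_circle_integral[symmetric])
      fix z assume "dist y z \<le> r * (norm h + norm (J h))"
      then have "z \<in> U"
        using sub that by blast
      then show "(f has_derivative frechet_derivative f (at z)) (at z)"
        "frechet_derivative f (at z) (J h) = \<i> * frechet_derivative f (at z) h"
        using C1_on_has_derivative[OF C1] J by blast+
    qed (rule r(1))
    have C1G: "C1_on V ?G"
      by (rule C1_on_integral_translates[OF f'(1,2) V(1,2) c v v_sub])
    have DG: "frechet_derivative ?G (at x) k = integral {0..1} (\<lambda>t. c t * f' (x + v t) k)" for k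
      by (rule frechet_derivative_integral_translates[OF f'(1,2) V(1,2) c v v_sub V(3)])
    have "(?g has_derivative frechet_derivative ?G (at x)) (at x)"
      using C1_on_has_derivative[OF C1G V(3)] V(1,3) eq
      by (rule has_derivative_transform_within_open)
    then have Dg: "frechet_derivative ?g (at x) = frechet_derivative ?G (at x)"
      by (rule frechet_derivative_at[symmetric])
    have "f' (x + v t) (J k) = \<i> * f' (x + v t) k" for t k
      using J f'(3) v_sub[OF V(3)] by metis
    then have "frechet_derivative ?g (at x) (J k) = \<i> * frechet_derivative ?g (at x) k" for k
      by (simp add: Dg DG mult.left_commute)
    with C1_on_cong[OF V(1) C1G eq] V show ?thesis
      by blast
  qed
  have "C1_on U ?g"
  proof (rule C1_on_local)
    fix x assume "x \<in> U"
    from local[OF this] show "\<exists>V. open V \<and> x \<in> V \<and> C1_on V ?g"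
      by (elim exE conjE) (rule exI, intro conjI)
  qed
  moreover have "frechet_derivative ?g (at x) (J k) = \<i> * frechet_derivative ?g (at x) k"
    if "x \<in> U" for x k
    using local[OF that] by (elim exE conjE) (erule spec)
  ultimately show ?thesis
    by (simp add: Hol_between_def)
qed

text \<open>
  Every coordinate \<open>y \<bullet> b\<close> is the real part of the functional \<open>\<phi> b y = y \<bullet> b - \<i> (K y \<bullet> b)\<close>, which
  is complex-linear in the sense that \<open>\<phi> b (K y) = \<i> * \<phi> b y\<close>.  Composing with these functionals
  reduces the claim to complex-valued maps, and they jointly separate points.
\<close>

lemma Hol_between_directional_derivative:
  fixes F :: "'a::euclidean_space \<Rightarrow> 'b::euclidean_space"
  assumes F: "F \<in> Hol_between J K U" and U: "open U"
    and K: "linear K" "\<And>y. K (K y) = - y"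
  shows "(\<lambda>x. frechet_derivative F (at x) h) \<in> Hol_between J K U"
proof -
  let ?G = "\<lambda>x. frechet_derivative F (at x) h"
  have C1: "C1_on U F" and J: "\<And>x h. x \<in> U \<Longrightarrow>
      frechet_derivative F (at x) (J h) = K (frechet_derivative F (at x) h)"
    using F by (auto simp: Hol_between_def)
  define \<phi> where "\<phi> b y = Complex (y \<bullet> b) (- (K y \<bullet> b))" for b y :: 'b
  have \<phi>_lin: "bounded_linear (\<phi> b)" for b
    by (rule linear_conv_bounded_linear[THEN iffD1], rule linearI)
      (simp_all add: \<phi>_def linear_add[OF K(1)] linear_scale[OF K(1)] inner_add_left
        complex_eq_iff)
  have \<phi>_K: "\<phi> b (K y) = \<i> * \<phi> b y" for b y
    by (simp add: \<phi>_def K(2) complex_eq_iff)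
  have \<phi>_D: "frechet_derivative (\<lambda>x. \<phi> b (F x)) (at x) k = \<phi> b (frechet_derivative F (at x) k)"
    if "x \<in> U" for b x k
    by (rule frechet_derivative_bounded_linear[OF \<phi>_lin C1 that])
  have "(\<lambda>x. \<phi> b (F x)) \<in> Hol_between J ((*) \<i>) U" for b
    unfolding Hol_between_def
    using C1_on_bounded_linear[OF \<phi>_lin C1] by (simp add: \<phi>_D J \<phi>_K)
  from Hol_between_directional_derivative_complex[OF this U]
  have D: "(\<lambda>x. frechet_derivative (\<lambda>x. \<phi> b (F x)) (at x) h) \<in> Hol_between J ((*) \<i>) U" for b .
  then have "C1_on U (\<lambda>x. \<Sum>b\<in>Basis. Re (frechet_derivative (\<lambda>x. \<phi> b (F x)) (at x) h) *\<^sub>R b)"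
    unfolding Hol_between_def
    by (intro C1_on_sum C1_on_bounded_linear[where T = "\<lambda>z. Re z *\<^sub>R _"])
      (auto intro: bounded_linear_compose[OF bounded_linear_scaleR_left bounded_linear_Re])
  then have C1G: "C1_on U ?G"
    by (rule C1_on_cong[OF U]) (simp add: \<phi>_D, simp add: \<phi>_def euclidean_representation)
  have "frechet_derivative ?G (at x) (J k) = K (frechet_derivative ?G (at x) k)" if x: "x \<in> U" for x k
  proof (rule euclidean_eqI)
    fix b :: 'b
    have "((\<lambda>x. frechet_derivative (\<lambda>x. \<phi> b (F x)) (at x) h) has_derivative
        (\<lambda>k. \<phi> b (frechet_derivative ?G (at x) k))) (at x)"
      using bounded_linear.has_derivative[OF \<phi>_lin C1_on_has_derivative[OF C1G x]] U x
      by (rule has_derivative_transform_within_open) (simp add: \<phi>_D)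
    from frechet_derivative_at[OF this, symmetric]
    have "\<phi> b (frechet_derivative ?G (at x) k) =
        frechet_derivative (\<lambda>x. frechet_derivative (\<lambda>x. \<phi> b (F x)) (at x) h) (at x) k" for k
      by simp
    then have "\<phi> b (frechet_derivative ?G (at x) (J k)) = \<phi> b (K (frechet_derivative ?G (at x) k))"
      using D[of b] x by (simp add: Hol_between_def \<phi>_K)
    then show "frechet_derivative ?G (at x) (J k) \<bullet> b = K (frechet_derivative ?G (at x) k) \<bullet> b"
      by (simp add: \<phi>_def)
  qed
  with C1G show ?thesis
    by (simp add: Hol_between_def)
qed

lemma Hol_between_imp_C2_on:
  fixes F :: "'a::euclidean_space \<Rightarrow> 'b::euclidean_space"
  assumes "F \<in> Hol_between J K U" "open U" "linear K" "\<And>y. K (K y) = - y"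
  shows "C2_on U F"
proof (rule C2_onI_directional[OF _ assms(2)])
  show "C1_on U F"
    using assms(1) by (simp add: Hol_between_def)
  show "C1_on U (\<lambda>x. frechet_derivative F (at x) h)" for h
    using Hol_between_directional_derivative[OF assms, of h] by (simp add: Hol_between_def)
qed

text \<open>
  One factor \<open>K\<close> comes from differentiating \<open>DF(x) (J h) = K (DF(x) h)\<close> in \<open>x\<close>, the other from the
  Cauchy-Riemann equation of \<open>x \<mapsto> DF(x) h\<close>.
\<close>

lemma Hol_between_second_derivative:
  fixes F :: "'a::euclidean_space \<Rightarrow> 'b::euclidean_space"
  assumes F: "F \<in> Hol_between J K U" and U: "open U" "x \<in> U"
    and K: "linear K" "\<And>y. K (K y) = - y"
  shows "frechet_derivative (\<lambda>x. frechet_derivative F (at x) (J h)) (at x) (J h) =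
    - frechet_derivative (\<lambda>x. frechet_derivative F (at x) h) (at x) h"
proof -
  let ?G = "\<lambda>h x. frechet_derivative F (at x) h"
  have G: "?G h \<in> Hol_between J K U" for h
    by (rule Hol_between_directional_derivative[OF F U(1) K])
  then have C1: "C1_on U (?G h)"
    by (simp add: Hol_between_def)
  have blK: "bounded_linear K"
    using K(1) by (simp add: linear_conv_bounded_linear)
  have "(?G (J h) has_derivative (\<lambda>k. K (frechet_derivative (?G h) (at x) k))) (at x)"
    using bounded_linear.has_derivative[OF blK C1_on_has_derivative[OF C1 U(2)]] U
    by (rule has_derivative_transform_within_open) (use F in \<open>simp add: Hol_between_def\<close>)
  from frechet_derivative_at[OF this, symmetric]
  have "frechet_derivative (?G (J h)) (at x) (J h) = K (frechet_derivative (?G h) (at x) (J h))"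
    by simp
  also have "\<dots> = K (K (frechet_derivative (?G h) (at x) h))"
    using G U(2) by (simp add: Hol_between_def)
  finally show ?thesis
    by (simp add: K(2))
qed

section \<open>The Laplacian on multicomplex space\<close>

lemma C1_on_mc_partial:
  assumes "C1_on U F" "x \<in> U"
  shows "mc_partial b F x = frechet_derivative F (at x) (mc_monomial b)"
proof -
  have "((\<lambda>t. F (x + t *\<^sub>R mc_monomial b)) has_derivative
      (\<lambda>t. frechet_derivative F (at x) (t *\<^sub>R mc_monomial b))) (at 0)"
    by (rule has_derivative_compose[where g = F])
      (use C1_on_has_derivative[OF assms] in \<open>auto intro!: derivative_eq_intros\<close>)
  then have "((\<lambda>t. F (x + t *\<^sub>R mc_monomial b)) has_vector_derivative
      frechet_derivative F (at x) (mc_monomial b)) (at 0)"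
    unfolding has_vector_derivative_def
    using has_derivative_linear[OF C1_on_has_derivative[OF assms]] by (simp add: linear_scale)
  then show ?thesis
    unfolding mc_partial_def by (rule vector_derivative_at)
qed

text \<open>
  The inner partial derivative is itself differentiated, so its description by the Frechet
  derivative has to hold in a neighbourhood of \<open>x\<close> and not only at \<open>x\<close>.
\<close>

lemma mc_laplacian_eq_frechet:
  fixes F :: "'n::finite multicomplex \<Rightarrow> 'b::real_normed_vector"
  assumes F: "C2_on U F" and U: "open U" "x \<in> U"
  shows "mc_laplacian F x = (\<Sum>b\<in>UNIV. frechet_derivative
    (\<lambda>x. frechet_derivative F (at x) (mc_monomial b)) (at x) (mc_monomial b))"
  unfolding mc_laplacian_def
proof (rule sum.cong[OF refl])
  fix b :: "bit ^ 'n"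
  let ?e = "mc_monomial b"
  have C1: "C1_on U F" and C1': "C1_on U (\<lambda>y. frechet_derivative F (at y) ?e)"
    using C2_on_imp_C1_on[OF F] C2_on_imp_C1_on_directional[OF F U(1)] .
  from C1' have C1'': "C1_on U (mc_partial b F)"
    by (rule C1_on_cong[OF U(1)]) (simp add: C1_on_mc_partial[OF C1])
  have "(mc_partial b F has_derivative
      frechet_derivative (\<lambda>y. frechet_derivative F (at y) ?e) (at x)) (at x)"
    using C1_on_has_derivative[OF C1' U(2)] U
    by (rule has_derivative_transform_within_open) (simp add: C1_on_mc_partial[OF C1])
  from frechet_derivative_at[OF this, symmetric]
  show "mc_partial b (mc_partial b F) x =
      frechet_derivative (\<lambda>y. frechet_derivative F (at y) ?e) (at x) ?e"
    by (simp add: C1_on_mc_partial[OF C1'' U(2)])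
qed

lemma mc_harmonic_on_bounded_linear:
  fixes F :: "'n::finite multicomplex \<Rightarrow> 'b::real_normed_vector"
  assumes F: "mc_harmonic_on U F" and U: "open U" and T: "bounded_linear T"
  shows "mc_harmonic_on U (\<lambda>x. T (F x))"
proof -
  have C2: "C2_on U F" and zero: "\<And>x. x \<in> U \<Longrightarrow> mc_laplacian F x = 0"
    using F by (auto simp: mc_harmonic_on_def)
  have TC2: "C2_on U (\<lambda>x. T (F x))"
    by (rule C2_on_bounded_linear[OF T C2])
  have "mc_laplacian (\<lambda>x. T (F x)) x = 0" if x: "x \<in> U" for x
  proof -
    have D: "frechet_derivative (\<lambda>x. frechet_derivative (\<lambda>x. T (F x)) (at x) h) (at x) k =
        T (frechet_derivative (\<lambda>x. frechet_derivative F (at x) h) (at x) k)" for h k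
    proof -
      have "((\<lambda>x. frechet_derivative (\<lambda>x. T (F x)) (at x) h) has_derivative
          (\<lambda>k. T (frechet_derivative (\<lambda>x. frechet_derivative F (at x) h) (at x) k))) (at x)"
        using bounded_linear.has_derivative[OF T
            C1_on_has_derivative[OF C2_on_imp_C1_on_directional[OF C2 U] x]] U x
        by (rule has_derivative_transform_within_open)
          (simp add: frechet_derivative_bounded_linear[OF T C2_on_imp_C1_on[OF C2]])
      from frechet_derivative_at[OF this, symmetric] show ?thesis
        by simp
    qed
    have "mc_laplacian (\<lambda>x. T (F x)) x = T (mc_laplacian F x)"
      unfolding mc_laplacian_eq_frechet[OF TC2 U x] mc_laplacian_eq_frechet[OF C2 U x] D
      by (rule linear_sum[OF bounded_linear.linear[OF T], symmetric])
    then show ?thesis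
      using zero[OF x] linear_0[OF bounded_linear.linear[OF T]] by simp
  qed
  with TC2 show ?thesis
    by (simp add: mc_harmonic_on_def)
qed

lemma mc_monomial_times:
  "mc_monomial a * mc_monomial b = mc_sign a b *\<^sub>R mc_monomial (a + b)"
  by (simp add: mc_monomial_eq mc_axis_times)

text \<open>
  With \<open>i = i^a\<close>, multiplication by \<open>i\<close> sends \<open>i^b\<close> to \<open>\<plusminus> i^(a + b)\<close>, and \<open>b \<mapsto> a + b\<close> is a bijection
  of the index set.
\<close>

lemma Hol_between_mc_harmonic_on:
  fixes F :: "'n::finite multicomplex \<Rightarrow> 'b::euclidean_space"
  assumes F: "F \<in> Hol_between (mc_mult i) K U" and U: "open U" and i: "i \<in> mc_monomials"
    and K: "linear K" "\<And>y. K (K y) = - y"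
  shows "mc_harmonic_on U F"
proof -
  have C2: "C2_on U F"
    by (rule Hol_between_imp_C2_on[OF F U K])
  obtain a where a: "i = mc_monomial a"
    using i by (auto simp: mc_monomials_def)
  have "mc_laplacian F x = 0" if x: "x \<in> U" for x
  proof -
    define S where "S h k = frechet_derivative (\<lambda>x. frechet_derivative F (at x) h) (at x) k" for h k
    have SJ: "S (i * h) (i * h) = - S h h" for h
      using Hol_between_second_derivative[OF F U x K] by (simp add: S_def mc_mult_def)
    have C1F: "C1_on U F" and C1G: "C1_on U (\<lambda>x. frechet_derivative F (at x) h)" for h
      using F Hol_between_directional_derivative[OF F U K] by (auto simp: Hol_between_def)
    have S2: "S h (s *\<^sub>R k) = s *\<^sub>R S h k" for h s k
      unfolding S_def by (rule linear_scale[OF has_derivative_linear[OF C1_on_has_derivative[OF C1G x]]])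
    have S1: "S (s *\<^sub>R h) k = s *\<^sub>R S h k" for h s k
    proof -
      have "((\<lambda>x. frechet_derivative F (at x) (s *\<^sub>R h)) has_derivative
          (\<lambda>k. s *\<^sub>R frechet_derivative (\<lambda>x. frechet_derivative F (at x) h) (at x) k)) (at x)"
        using has_derivative_scaleR_right[OF C1_on_has_derivative[OF C1G x]] U x
        by (rule has_derivative_transform_within_open)
          (simp add: linear_scale[OF has_derivative_linear[OF C1_on_has_derivative[OF C1F]]])
      from frechet_derivative_at[OF this, symmetric] show ?thesis
        by (simp add: S_def)
    qed
    \<comment> \<open>The sign from \<open>i * i^b\<close> enters \<open>S\<close> in both arguments, and its square is \<open>1\<close>.\<close>
    have S_shift: "S (mc_monomial (a + b)) (mc_monomial (a + b)) = - S (mc_monomial b) (mc_monomial b)" for b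
      using SJ[of "mc_monomial b"] by (simp add: a mc_monomial_times S1 S2 mc_sign_square)
    have "mc_laplacian F x = (\<Sum>b\<in>UNIV. S (mc_monomial b) (mc_monomial b))"
      unfolding S_def by (rule mc_laplacian_eq_frechet[OF C2 U x])
    also have "\<dots> = (\<Sum>b\<in>UNIV. S (mc_monomial (a + b)) (mc_monomial (a + b)))"
      by (rule sum.reindex_bij_witness[where i = "\<lambda>b. a + b" and j = "\<lambda>b. a + b"]) auto
    also have "\<dots> = - (\<Sum>b\<in>UNIV. S (mc_monomial b) (mc_monomial b))"
      by (simp add: S_shift sum_negf)
    also have "(\<Sum>b\<in>UNIV. S (mc_monomial b) (mc_monomial b)) = mc_laplacian F x"
      unfolding S_def by (rule mc_laplacian_eq_frechet[OF C2 U x, symmetric])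
    finally have "2 *\<^sub>R mc_laplacian F x = 0"
      unfolding scaleR_2 by (simp only: eq_neg_iff_add_eq_0)
    then show ?thesis
      by simp
  qed
  with C2 show ?thesis
    by (simp add: mc_harmonic_on_def)
qed

theorem corollary4p15:
  fixes U :: "'n::finite multicomplex set"
    and i :: "'n multicomplex"
    and F :: "'n multicomplex \<Rightarrow> 'n multicomplex"
  assumes "open U"
    and "i \<in> mc_monomials"
    and "i^2 = -1"
    and "F \<in> Hol i U \<or> F \<in> antiHol i U"
  shows "mc_harmonic_on U F \<and> (\<forall>b. mc_harmonic_on U (\<lambda>x. mc_coord b (F x)))"
proof -
  obtain j where j: "j * j = -1" and F: "F \<in> Hol_between (mc_mult i) (mc_mult j) U"
  proof -
    have "i * i = -1" "(- i) * (- i) = -1"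
      using assms(3) by (simp_all add: power2_eq_square)
    moreover have "F \<in> Hol_between (mc_mult i) (mc_mult i) U \<or>
        F \<in> Hol_between (mc_mult i) (mc_mult (- i)) U"
      using assms(4) by (auto simp: Hol_def antiHol_def Hol_between_def mc_mult_def fun_eq_iff)
    ultimately show thesis
      using that by blast
  qed
  have harm: "mc_harmonic_on U F"
  proof (rule Hol_between_mc_harmonic_on[OF F assms(1,2)])
    show "linear (mc_mult j)"
      by (rule linearI) (simp_all add: mc_mult_def distrib_left)
    show "mc_mult j (mc_mult j y) = - y" for y
      by (simp add: mc_mult_def j flip: mult.assoc)
  qed
  moreover have "mc_harmonic_on U (\<lambda>x. mc_coord b (F x))" for b
  proof (rule mc_harmonic_on_bounded_linear[OF harm assms(1)])
    show "bounded_linear (mc_coord b :: 'n multicomplex \<Rightarrow> real)"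
      unfolding mc_inner_monomial[symmetric, abs_def] by (rule bounded_linear_inner_left)
  qed
  ultimately show ?thesis
    by blast
qed

end
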